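(* Let $(M, M')$ be a matroid perspective on a finite ground set $E$ with a total ordering $<$ on $E$. Then the trivariate Tutte polynomial of $(M,M')$ can be expressed as $$T_{M,M'}(x,y,z) = \sum_{X\in \mathcal{D}(M, M', <)} x^{r(M'/X)}\,y^{r^*(M|X)}\,z^{r(M) - r(M') - (r_M(X) - r_{M'}(X))}.$$
   Context: Matroids are on a finite ground set $E$; $r(N)$ is the rank of a matroid $N$, $r_N(X)$ the rank in $N$ of a subset $X$, and $N^*$ the dual of $N$. $M|X$ is the restriction of $M$ to $X$ (ground set $X$), $M'/X$ is the contraction of $M'$ by $X$ (ground set $E\setminus X$), and $r^*(M|X)$ denotes the rank of the dual matroid $(M|X)^*$. An $N$-circuit is a circuit of $N$. $X\cup e$ means $X\cup\{e\}$. Matroid perspective: a pair $(M,M')$ of matroids on a common ground set $E$ is a matroid perspective if every circuit of $M$ is a union of circuits of $M'$. Activities: for a matroid $N$ on $E$ with total ordering $<$ on $E$, and $X\subseteq E$, $$\mathrm{Int}_N(X) := \{e\in X : (E\setminus X)\cup e \text{ contains an } N^*\text{-circuit with } e \text{ as its minimal element}\},$$ $$\mathrm{Ext}_N(X) := \{e\in E\setminus X : X\cup e \text{ contains an } N\text{-circuit with } e \text{ as its minimal element}\}.$$ Trivariate Tutte polynomial (Las Vergnas), in its internal-external activities description: for a matroid perspective $(M,M')$ on $E$ with total ordering $<$, $$T_{M, M'}(x,y,z) = \sum_{B} x^{|\mathrm{Int}_{M'}(B)|}\,y^{|\mathrm{Ext}_M(B)|}\,z^{r(M) - r(M') - (r_M(B)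 - r_{M'}(B))},$$ where the sum is over all $B\subseteq E$ that are independent in $M$ and spanning in $M'$. Compatibility: a set $X\subseteq E$ is $(N,<)$-compatible if there is no $N$-circuit $C$ with $X\cap C=\{\min(C)\}$. The set $\mathcal{D}(M,M',<)$ is $$\mathcal{D}(M, M', <) := \{X\subseteq E : X \text{ is } ((M')^*,<)\text{-compatible and } E\setminus X \text{ is } (M,<)\text{-compatible}\}.$$ *)

theory Defs
  imports Main
begin

datatype 'a pre_matroid = Pre_Matroid (ground: "'a set") (indeps: "'a set set")

definition matroid :: "'a pre_matroid \<Rightarrow> bool" where
  "matroid N \<longleftrightarrow>
     finite (ground N) \<and>
     indeps N \<subseteq> Pow (ground N) \<and>
     {} \<in> indeps N \<and>
     (\<forall>I J. I \<in> indeps N \<longrightarrow> J \<subseteq> I \<longrightarrow> J \<in> indeps N) \<and>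
     (\<forall>I J. I \<in> indeps N \<longrightarrow> J \<in> indeps N \<longrightarrow> card I < card J \<longrightarrow>
        (\<exists>e \<in> J - I. insert e I \<in> indeps N))"

definition circuit :: "'a pre_matroid \<Rightarrow> 'a set \<Rightarrow> bool" where
  "circuit N C \<longleftrightarrow> C \<subseteq> ground N \<and> C \<notin> indeps N \<and> (\<forall>D. D \<subset> C \<longrightarrow> D \<in> indeps N)"

definition basis :: "'a pre_matroid \<Rightarrow> 'a set \<Rightarrow> bool" where
  "basis N B \<longleftrightarrow> B \<in> indeps N \<and> (\<forall>I \<in> indeps N. B \<subseteq> I \<longrightarrow> I = B)"

definition rank_of :: "'a pre_matroid \<Rightarrow> 'a set \<Rightarrow> nat" where
  "rank_of N X = Max (card ` {I \<in> indeps N. I \<subseteq> X})"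

definition rank :: "'a pre_matroid \<Rightarrow> nat" where
  "rank N = rank_of N (ground N)"

definition spanning :: "'a pre_matroid \<Rightarrow> 'a set \<Rightarrow> bool" where
  "spanning N X \<longleftrightarrow> X \<subseteq> ground N \<and> rank_of N X = rank N"

definition dual :: "'a pre_matroid \<Rightarrow> 'a pre_matroid" where
  "dual N = Pre_Matroid (ground N) {I. \<exists>B. basis N B \<and> I \<subseteq> ground N - B}"

text \<open>Restriction and contraction are meant for subsets \<open>X\<close> of the ground set.\<close>

definition restriction :: "'a pre_matroid \<Rightarrow> 'a set \<Rightarrow> 'a pre_matroid" where
  "restriction N X = Pre_Matroid X {I \<in> indeps N. I \<subseteq> X}"

definition contraction :: "'a pre_matroid \<Rightarrow> 'a set \<Rightarrow> 'a pre_matroid" where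
  "contraction N X =
     Pre_Matroid (ground N - X)
       {I. I \<subseteq> ground N - X \<and> (\<exists>J. basis (restriction N X) J \<and> I \<union> J \<in> indeps N)}"

definition matroid_perspective :: "'a pre_matroid \<Rightarrow> 'a pre_matroid \<Rightarrow> bool" where
  "matroid_perspective M M' \<longleftrightarrow>
     matroid M \<and> matroid M' \<and> ground M = ground M' \<and>
     (\<forall>C. circuit M C \<longrightarrow> (\<exists>\<D>. (\<forall>D \<in> \<D>. circuit M' D) \<and> C = \<Union>\<D>))"

text \<open>
  Below, a total ordering of the ground set is a strict order relation \<open>lt\<close>, where
  \<open>(a, b) \<in> lt\<close> means \<open>a < b\<close>.
\<close>

definition is_minimum :: "'a rel \<Rightarrow> 'a set \<Rightarrow> 'a \<Rightarrow> bool" where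
  "is_minimum lt C e \<longleftrightarrow> e \<in> C \<and> (\<forall>f \<in> C. f \<noteq> e \<longrightarrow> (e, f) \<in> lt)"

definition int_active :: "'a pre_matroid \<Rightarrow> 'a rel \<Rightarrow> 'a set \<Rightarrow> 'a set" where
  "int_active N lt X =
     {e \<in> X. \<exists>C. circuit (dual N) C \<and> C \<subseteq> insert e (ground N - X) \<and> is_minimum lt C e}"

definition ext_active :: "'a pre_matroid \<Rightarrow> 'a rel \<Rightarrow> 'a set \<Rightarrow> 'a set" where
  "ext_active N lt X =
     {e \<in> ground N - X. \<exists>C. circuit N C \<and> C \<subseteq> insert e X \<and> is_minimum lt C e}"

text \<open>
  The integer \<open>r(M) - r(M') - (r_M(X) - r_{M'}(X))\<close> is nonnegative whenever \<open>(M, M')\<close> is a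
  matroid perspective and \<open>X\<close> is a subset of the ground set, so \<open>nat\<close> truncates nothing there.
\<close>

definition z_exponent :: "'a pre_matroid \<Rightarrow> 'a pre_matroid \<Rightarrow> 'a set \<Rightarrow> nat" where
  "z_exponent M M' X =
     nat (int (rank M) - int (rank M') - (int (rank_of M X) - int (rank_of M' X)))"

text \<open>
  The polynomial is represented by its values at elements of an arbitrary commutative ring.
  Instantiating the ring with \<open>int poly poly poly\<close> and \<open>x\<close>, \<open>y\<close>, \<open>z\<close> with the three
  indeterminates yields the formal polynomial.
\<close>

definition trivariate_tutte ::
  "'a pre_matroid \<Rightarrow> 'a pre_matroid \<Rightarrow> 'a rel \<Rightarrow> 'b \<Rightarrow> 'b \<Rightarrow> 'b \<Rightarrow> 'b::comm_ring_1" where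
  "trivariate_tutte M M' lt x y z =
     (\<Sum>B \<in> {B. B \<subseteq> ground M \<and> B \<in> indeps M \<and> spanning M' B}.
        x ^ card (int_active M' lt B) * y ^ card (ext_active M lt B) * z ^ z_exponent M M' B)"

definition compatible :: "'a pre_matroid \<Rightarrow> 'a rel \<Rightarrow> 'a set \<Rightarrow> bool" where
  "compatible N lt X \<longleftrightarrow> \<not> (\<exists>C e. circuit N C \<and> is_minimum lt C e \<and> X \<inter> C = {e})"

definition compatible_sets :: "'a pre_matroid \<Rightarrow> 'a pre_matroid \<Rightarrow> 'a rel \<Rightarrow> 'a set set" where
  "compatible_sets M M' lt =
     {X. X \<subseteq> ground M \<and> compatible (dual M') lt X \<and> compatible M lt (ground M - X)}"

end

theory Submission
  imports Defs
begin

text \<open>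
  For an arbitrary \<open>X \<subseteq> E\<close>, call \<open>e\<close> externally active if \<open>e \<in> cl\<^sub>M(X\<^sub>>\<^sub>e)\<close> and internally active if
  \<open>e \<notin> cl\<^sub>M\<^sub>'(X\<^sub>>\<^sub>e \<union> E\<^sub><\<^sub>e)\<close>, whether or not \<open>e \<in> X\<close>. In a perspective no element is both. The sets
  independent in \<open>M\<close> and spanning in \<open>M'\<close> are those containing every internally and no externally
  active element; the sets in \<open>\<D>(M,M',<)\<close> are those containing every externally and no internally
  active element. Adding or removing one active element changes neither kind of activity, by the
  exchange property. Hence toggling the membership of all active elements is an involution that
  swaps the two families, and the exponents are read off quantities invariant under each single
  toggle.
\<close>

section \<open>Rank and closure\<close>

definition cl :: "'a pre_matroid \<Rightarrow> 'a set \<Rightarrow> 'a set" where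
  "cl N A = {e \<in> ground N. rank_of N (insert e A) = rank_of N A}"

context
  fixes N :: "'a pre_matroid"
  assumes N: "matroid N"
begin

lemma finite_ground: "finite (ground N)"
  using N by (simp add: matroid_def)

lemma indep_subset_ground: "I \<in> indeps N \<Longrightarrow> I \<subseteq> ground N"
  using N by (auto simp: matroid_def)

lemma finite_indep: "I \<in> indeps N \<Longrightarrow> finite I"
  using finite_ground indep_subset_ground finite_subset by blast

lemma indep_empty: "{} \<in> indeps N"
  using N by (simp add: matroid_def)

lemma indep_mono: "I \<in> indeps N \<Longrightarrow> J \<subseteq> I \<Longrightarrow> J \<in> indeps N"
  using N unfolding matroid_def by blast

lemma indep_augment:
  "I \<in> indeps N \<Longrightarrow> J \<in> indeps N \<Longrightarrow> card I < card J \<Longrightarrow> \<exists>e \<in> J - I. insert e I \<in> indeps N"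
  using N by (simp add: matroid_def)

lemma finite_indep_cards: "finite (card ` {I \<in> indeps N. I \<subseteq> X})"
proof -
  have "indeps N \<subseteq> Pow (ground N)"
    using indep_subset_ground by blast
  then have "finite (indeps N)"
    using finite_ground by (meson finite_Pow_iff finite_subset)
  then show ?thesis by simp
qed

lemma card_le_rank_of: "I \<in> indeps N \<Longrightarrow> I \<subseteq> X \<Longrightarrow> card I \<le> rank_of N X"
  unfolding rank_of_def by (rule Max_ge[OF finite_indep_cards]) auto

lemma rank_of_attained:
  obtains J where "J \<in> indeps N" "J \<subseteq> X" "card J = rank_of N X"
proof -
  have "card ` {I \<in> indeps N. I \<subseteq> X} \<noteq> {}"
    using indep_empty by auto
  from Max_in[OF finite_indep_cards this] show ?thesis
    using that unfolding rank_of_def by fastforce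
qed

text \<open>Augmenting \<open>I\<close> from an independent subset of \<open>X\<close> of maximum
  size never leaves \<open>X\<close> and shrinks the gap \<open>rank_of N X - card I\<close>, on
  which the induction runs.\<close>

lemma indep_extend:
  assumes "I \<in> indeps N" "I \<subseteq> X"
  obtains J where "J \<in> indeps N" "I \<subseteq> J" "J \<subseteq> X" "card J = rank_of N X"
proof -
  have "\<exists>J \<in> indeps N. I \<subseteq> J \<and> J \<subseteq> X \<and> card J = rank_of N X"
    using assms
  proof (induction "rank_of N X - card I" arbitrary: I rule: less_induct)
    case less
    obtain K where K: "K \<in> indeps N" "K \<subseteq> X" "card K = rank_of N X"
      by (rule rank_of_attained)
    show ?case
    proof (cases "card I < card K")
      case True
      then obtain e where e: "e \<in> K - I" "insert e I \<in> indeps N"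
        using indep_augment less.prems K by blast
      have "card (insert e I) = Suc (card I)"
        using e finite_indep[OF less.prems(1)] by simp
      then have "rank_of N X - card (insert e I) < rank_of N X - card I"
        using True K by simp
      moreover have "insert e I \<subseteq> X" using e K less.prems by auto
      ultimately have "\<exists>J \<in> indeps N. insert e I \<subseteq> J \<and> J \<subseteq> X \<and> card J = rank_of N X"
        using less.hyps e(2) by blast
      then show ?thesis by auto
    next
      case False
      then show ?thesis
        using card_le_rank_of[OF less.prems] less.prems K(3) by (intro bexI[of _ I]) auto
    qed
  qed
  then show ?thesis using that by blast
qed

lemma rank_of_mono: "A \<subseteq> B \<Longrightarrow> rank_of N A \<le> rank_of N B"
  by (metis card_le_rank_of order_trans rank_of_attained)

lemma rank_of_insert_le: "rank_of N (insert e A) \<le> Suc (rank_of N A)"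
proof -
  obtain J where J: "J \<in> indeps N" "J \<subseteq> insert e A" "card J = rank_of N (insert e A)"
    by (rule rank_of_attained)
  have "card (J - {e}) \<le> rank_of N A"
    using J indep_mono[OF J(1)] by (intro card_le_rank_of) auto
  moreover have "card J \<le> Suc (card (J - {e}))"
    by (auto simp: card_Diff_singleton_if)
  ultimately show ?thesis using J(3) by simp
qed

lemma rank_of_indep:
  assumes "I \<in> indeps N" shows "rank_of N I = card I"
  by (metis assms card_mono card_le_rank_of finite_indep le_antisym order_refl rank_of_attained)

lemma basis_iff_card: "basis N B \<longleftrightarrow> B \<in> indeps N \<and> card B = rank N"
proof
  assume B: "basis N B"
  then have "B \<in> indeps N" by (simp add: basis_def)
  moreover obtain J where "J \<in> indeps N" "B \<subseteq> J" "card J = rank_of N (ground N)"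
    using indep_extend calculation indep_subset_ground by metis
  ultimately show "B \<in> indeps N \<and> card B = rank N"
    using B by (auto simp: basis_def rank_def)
next
  assume B: "B \<in> indeps N \<and> card B = rank N"
  show "basis N B"
    unfolding basis_def
  proof (intro conjI ballI impI)
    fix I assume I: "I \<in> indeps N" "B \<subseteq> I"
    then have "card I \<le> card B"
      using B card_le_rank_of[OF I(1) indep_subset_ground] by (simp add: rank_def)
    then show "I = B"
      using I finite_indep card_seteq by metis
  qed (use B in simp)
qed

lemma cl_subset_ground: "cl N A \<subseteq> ground N"
  by (auto simp: cl_def)

lemma subset_cl: "A \<subseteq> ground N \<Longrightarrow> A \<subseteq> cl N A"
  by (auto simp: cl_def insert_absorb)

lemma rank_of_insert:
  "e \<in> ground N \<Longrightarrow> rank_of N (insert e A) = (if e \<in> cl N A then rank_of N A else Suc (rank_of N A))"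
  using rank_of_insert_le[of e A] rank_of_mono[OF subset_insertI, of A e] by (auto simp: cl_def)

text \<open>If \<open>e\<close> raises the rank of \<open>A\<close>, a maximum independent subset of
  \<open>insert e A\<close> extending \<open>I\<close> has to use \<open>e\<close>, so
  \<open>insert e I\<close> is independent. Any single maximum independent \<open>I\<close> thus
  decides membership in the closure.\<close>

lemma mem_cl_iff_dependent:
  assumes "e \<in> ground N" "I \<in> indeps N" "I \<subseteq> A" "card I = rank_of N A" "e \<notin> A"
  shows "e \<in> cl N A \<longleftrightarrow> insert e I \<notin> indeps N"
proof
  assume "e \<in> cl N A"
  then show "insert e I \<notin> indeps N"
    using assms card_le_rank_of[of "insert e I" "insert e A"] finite_indep[of I]
      subset_insertI2[of I A e] by (auto simp: cl_def card_insert_if split: if_splits)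
next
  assume dep: "insert e I \<notin> indeps N"
  show "e \<in> cl N A"
  proof (rule ccontr)
    assume "e \<notin> cl N A"
    then have r: "rank_of N (insert e A) = Suc (rank_of N A)"
      using rank_of_insert assms(1) by simp
    obtain J where J: "J \<in> indeps N" "I \<subseteq> J" "J \<subseteq> insert e A" "card J = rank_of N (insert e A)"
      using indep_extend[of I "insert e A"] assms by blast
    have "e \<notin> J"
      using dep J indep_mono[OF J(1), of "insert e I"] by blast
    then have "card J \<le> rank_of N A"
      using J by (intro card_le_rank_of) auto
    then show False using J r by simp
  qed
qed

text \<open>A maximum independent subset of \<open>A\<close> extends to one of \<open>B\<close>, and
  dependence after adding \<open>e\<close> passes to supersets.\<close>

lemma cl_mono:
  assumes "A \<subseteq> B" "B \<subseteq> ground N"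
  shows "cl N A \<subseteq> cl N B"
proof
  fix e assume e: "e \<in> cl N A"
  show "e \<in> cl N B"
  proof (cases "e \<in> B")
    case True
    then show ?thesis using subset_cl assms by blast
  next
    case False
    obtain I where I: "I \<in> indeps N" "I \<subseteq> A" "card I = rank_of N A"
      by (rule rank_of_attained)
    obtain J where J: "J \<in> indeps N" "I \<subseteq> J" "J \<subseteq> B" "card J = rank_of N B"
      using indep_extend[of I B] I assms by blast
    have eg: "e \<in> ground N" and "e \<notin> A"
      using e False assms cl_subset_ground by auto
    have "insert e I \<notin> indeps N"
      using mem_cl_iff_dependent[OF eg I \<open>e \<notin> A\<close>] e by simp
    then have "insert e J \<notin> indeps N"
      using J(2) indep_mono by (metis insert_mono)
    then show ?thesis
      using mem_cl_iff_dependent[OF eg J(1,3,4) False] by simp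
  qed
qed

lemma cl_insert_absorb:
  assumes "f \<in> cl N A" "A \<subseteq> ground N"
  shows "cl N (insert f A) = cl N A"
proof
  show "cl N A \<subseteq> cl N (insert f A)"
    using assms cl_subset_ground by (intro cl_mono) auto
  show "cl N (insert f A) \<subseteq> cl N A"
  proof
    fix e assume e: "e \<in> cl N (insert f A)"
    have "rank_of N (insert e A) \<le> rank_of N (insert e (insert f A))"
      by (rule rank_of_mono) auto
    also have "\<dots> = rank_of N A"
      using e assms by (simp add: cl_def)
    finally show "e \<in> cl N A"
      using e rank_of_mono[OF subset_insertI, of A e] by (auto simp: cl_def)
  qed
qed

text \<open>Steinitz exchange: \<open>e\<close> alone raises the rank of \<open>A\<close> by one,
  which is as much as \<open>e\<close> and \<open>f\<close> together can raise it.\<close>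

lemma cl_exchange:
  assumes "e \<in> cl N (insert f A)" "e \<notin> cl N A" "f \<in> ground N"
  shows "f \<in> cl N (insert e A)"
proof -
  have e: "e \<in> ground N" using assms cl_subset_ground by blast
  have "rank_of N (insert f (insert e A)) = rank_of N (insert f A)"
    using assms by (simp add: cl_def insert_commute)
  also have "\<dots> \<le> Suc (rank_of N A)"
    by (rule rank_of_insert_le)
  also have "\<dots> = rank_of N (insert e A)"
    using assms rank_of_insert[OF e] by simp
  finally have "rank_of N (insert f (insert e A)) = rank_of N (insert e A)"
    using rank_of_mono[OF subset_insertI, of "insert e A" f] by auto
  then show ?thesis using assms by (simp add: cl_def)
qed

section \<open>Closure in terms of circuits\<close>

lemma dependent_contains_circuit:
  assumes "A \<subseteq> ground N" "A \<notin> indeps N"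
  obtains C where "circuit N C" "C \<subseteq> A"
proof -
  have "finite A" using assms finite_ground finite_subset by blast
  then have "\<exists>C \<subseteq> A. C \<notin> indeps N \<and> (\<forall>D. D \<subset> C \<longrightarrow> D \<in> indeps N)"
    using assms(2)
  proof (induction A rule: finite_psubset_induct)
    case (psubset A)
    show ?case
    proof (cases "\<forall>D. D \<subset> A \<longrightarrow> D \<in> indeps N")
      case True
      then show ?thesis using psubset.prems by blast
    next
      case False
      then obtain D where "D \<subset> A" "D \<notin> indeps N" by blast
      then obtain C where "C \<subseteq> D" "C \<notin> indeps N" "\<forall>D. D \<subset> C \<longrightarrow> D \<in> indeps N"
        using psubset.IH[of D] by metis
      then show ?thesis using \<open>D \<subset> A\<close> by (intro exI[of _ C]) auto
    qed
  qed
  then obtain C where "C \<subseteq> A" "C \<notin> indeps N" "\<forall>D. D \<subset> C \<longrightarrow> D \<in> indeps N"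
    by metis
  then have "circuit N C" using assms(1) by (simp add: circuit_def)
  then show ?thesis using that \<open>C \<subseteq> A\<close> by simp
qed

lemma circuit_subset_dependent:
  assumes "circuit N C" "C \<subseteq> A" shows "A \<notin> indeps N"
  using assms indep_mono[of A C] by (auto simp: circuit_def)

text \<open>Links closure to the circuits by which activities are defined. A circuit inside
  \<open>insert e I\<close>, with \<open>I\<close> independent, must use \<open>e\<close>;
  conversely, a maximum independent subset of \<open>A\<close> containing \<open>C - {e}\<close>
  becomes dependent with \<open>e\<close>.\<close>

lemma mem_cl_iff_circuit:
  assumes "e \<in> ground N" "A \<subseteq> ground N" "e \<notin> A"
  shows "e \<in> cl N A \<longleftrightarrow> (\<exists>C. circuit N C \<and> e \<in> C \<and> C \<subseteq> insert e A)"
proof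
  assume e: "e \<in> cl N A"
  obtain I where I: "I \<in> indeps N" "I \<subseteq> A" "card I = rank_of N A"
    by (rule rank_of_attained)
  have "insert e I \<notin> indeps N"
    using mem_cl_iff_dependent[OF assms(1) I assms(3)] e by simp
  moreover have "insert e I \<subseteq> ground N"
    using I assms by auto
  ultimately obtain C where C: "circuit N C" "C \<subseteq> insert e I"
    using dependent_contains_circuit by blast
  have "e \<in> C"
    using circuit_subset_dependent[OF C(1), of I] C(2) I(1) by blast
  then show "\<exists>C. circuit N C \<and> e \<in> C \<and> C \<subseteq> insert e A"
    using C I by blast
next
  assume "\<exists>C. circuit N C \<and> e \<in> C \<and> C \<subseteq> insert e A"
  then obtain C where C: "circuit N C" "e \<in> C" "C \<subseteq> insert e A" by blast
  have "C - {e} \<in> indeps N" using C by (auto simp: circuit_def)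
  then obtain J where J: "J \<in> indeps N" "C - {e} \<subseteq> J" "J \<subseteq> A" "card J = rank_of N A"
    using indep_extend[of "C - {e}" A] C by blast
  have "insert e J \<notin> indeps N"
    using J(2) by (intro circuit_subset_dependent[OF C(1)]) auto
  then show "e \<in> cl N A"
    using mem_cl_iff_dependent[OF assms(1) J(1,3,4) assms(3)] by simp
qed

section \<open>Duals and minors\<close>

lemma ground_dual [simp]: "ground (dual N) = ground N"
  by (simp add: dual_def)

text \<open>The complement of \<open>I\<close> has full rank exactly if it contains a basis.\<close>

lemma indep_dual_iff: "I \<in> indeps (dual N) \<longleftrightarrow> I \<subseteq> ground N \<and> rank_of N (ground N - I) = rank N"
proof
  assume "I \<in> indeps (dual N)"
  then obtain B where B: "basis N B" "I \<subseteq> ground N - B" by (auto simp: dual_def)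
  then have "B \<in> indeps N" "card B = rank N" by (auto simp: basis_iff_card)
  then have "rank N \<le> rank_of N (ground N - I)"
    using card_le_rank_of[of B "ground N - I"] B indep_subset_ground by auto
  then show "I \<subseteq> ground N \<and> rank_of N (ground N - I) = rank N"
    using B rank_of_mono[of "ground N - I" "ground N"] by (auto simp: rank_def)
next
  assume I: "I \<subseteq> ground N \<and> rank_of N (ground N - I) = rank N"
  obtain J where "J \<in> indeps N" "J \<subseteq> ground N - I" "card J = rank_of N (ground N - I)"
    by (rule rank_of_attained)
  then show "I \<in> indeps (dual N)"
    using I by (auto simp: dual_def basis_iff_card)
qed

text \<open>The exchange property is a count. Take a basis \<open>K\<close> missing \<open>J\<close>
  and a basis \<open>B\<close> missing \<open>I\<close> and containing \<open>K - I\<close>. If no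
  element of \<open>J - I\<close> can be added to \<open>I\<close>, then \<open>B\<close> contains
  \<open>J - I\<close> as well, and comparing sizes forces
  \<open>card (J - I) \<le> card (I - J)\<close>.\<close>

lemma matroid_dual: "matroid (dual N)"
  unfolding matroid_def
proof (intro conjI allI impI)
  show "finite (ground (dual N))" by (simp add: finite_ground)
  show "indeps (dual N) \<subseteq> Pow (ground (dual N))" by (auto simp: indep_dual_iff)
  show "{} \<in> indeps (dual N)" by (simp add: indep_dual_iff rank_def)
  fix I J
  {
    assume "I \<in> indeps (dual N)" "J \<subseteq> I"
    then show "J \<in> indeps (dual N)" by (auto simp: dual_def)
  next
    assume I: "I \<in> indeps (dual N)" and J: "J \<in> indeps (dual N)" and less: "card I < card J"
    have fin: "finite I" "finite J"
      using I J finite_ground finite_subset by (auto simp: indep_dual_iff)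
    obtain K where K: "K \<in> indeps N" "K \<subseteq> ground N - J" "card K = rank N"
      using J rank_of_attained[of "ground N - J"] by (auto simp: indep_dual_iff)
    have "K - I \<in> indeps N" "K - I \<subseteq> ground N - I"
      using K indep_mono by auto
    then obtain B where B: "B \<in> indeps N" "K - I \<subseteq> B" "B \<subseteq> ground N - I" "card B = rank N"
      using indep_extend I by (metis indep_dual_iff)
    show "\<exists>e \<in> J - I. insert e I \<in> indeps (dual N)"
    proof (rule ccontr)
      assume contr: "\<not> ?thesis"
      have sub: "J - I \<subseteq> B"
      proof
        fix e assume e: "e \<in> J - I"
        show "e \<in> B"
        proof (rule ccontr)
          assume "e \<notin> B"
          then have "B \<subseteq> ground N - insert e I" using B by auto
          then have "rank N \<le> rank_of N (ground N - insert e I)"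
            using card_le_rank_of[OF B(1)] B(4) by metis
          then have "insert e I \<in> indeps (dual N)"
            using e I J rank_of_mono[of "ground N - insert e I" "ground N"]
            by (auto simp: indep_dual_iff rank_def)
          then show False using contr e by blast
        qed
      qed
      have finK: "finite K" "finite B" using K B finite_indep by auto
      have "card (K - I) + card (J - I) = card ((K - I) \<union> (J - I))"
        using K fin finK by (intro card_Un_disjoint[symmetric]) auto
      also have "\<dots> \<le> card B"
        using sub B finK by (intro card_mono) auto
      finally have 1: "card (K - I) + card (J - I) \<le> rank N" using B by simp
      \<comment> \<open>\<open>K\<close> misses \<open>J\<close>, so its part in \<open>I\<close>
        lies in \<open>I - J\<close>.\<close>
      have "card (K \<inter> I) \<le> card (I - J)"
        using K fin by (intro card_mono) auto
      moreover have "card K = card (K \<inter> I) + card (K - I)"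
        using finK by (metis card_Int_Diff)
      moreover have "card I = card (I \<inter> J) + card (I - J)" "card J = card (J \<inter> I) + card (J - I)"
        using fin by (metis card_Int_Diff)+
      ultimately show False
        using 1 less K(3) by (simp add: Int_commute)
    qed
  }
qed

text \<open>For one bound, a maximum independent subset of \<open>ground N - A\<close> grows to a
  basis \<open>B\<close>, and \<open>A - B\<close> is independent in the dual. For the other, a
  basis \<open>B\<close> disjoint from a maximum dual-independent \<open>I \<subseteq> A\<close> has
  at most \<open>card A - card I\<close> elements in \<open>A\<close>.\<close>

lemma rank_of_dual:
  assumes A: "A \<subseteq> ground N"
  shows "rank_of (dual N) A + rank N = card A + rank_of N (ground N - A)"
proof (rule antisym)
  have finA: "finite A" using A finite_ground finite_subset by blast
  obtain I where I: "I \<in> indeps N" "I \<subseteq> ground N - A" "card I = rank_of N (ground N - A)"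
    by (rule rank_of_attained)
  obtain B where B: "B \<in> indeps N" "I \<subseteq> B" "B \<subseteq> ground N" "card B = rank N"
    using indep_extend[of I "ground N"] I unfolding rank_def by blast
  have "A - B \<in> indeps (dual N)"
    using A B by (auto simp: dual_def basis_iff_card)
  then have "card (A - B) \<le> rank_of (dual N) A"
    unfolding rank_of_def
    by (intro Max_ge) (use finite_ground in \<open>auto simp: dual_def intro!: finite_imageI finite_subset[of _ "Pow (ground N)"]\<close>)
  moreover have "card (B - A) \<le> rank_of N (ground N - A)"
    using B indep_mono by (intro card_le_rank_of) auto
  moreover have "card A = card (A \<inter> B) + card (A - B)" "card B = card (B \<inter> A) + card (B - A)"
    using finA finite_indep[OF B(1)] by (metis card_Int_Diff)+
  moreover have "card I \<le> card (B - A)"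
    using I B finite_indep by (intro card_mono) auto
  ultimately show "card A + rank_of N (ground N - A) \<le> rank_of (dual N) A + rank N"
    using I B by (simp add: Int_commute)
next
  have finA: "finite A" using A finite_ground finite_subset by blast
  have "finite (card ` {I \<in> indeps (dual N). I \<subseteq> A})"
    using finA by (auto intro!: finite_imageI finite_subset[of _ "Pow A"])
  moreover have "card ` {I \<in> indeps (dual N). I \<subseteq> A} \<noteq> {}"
    by (auto simp: indep_dual_iff rank_def intro!: exI[of _ "{}"])
  ultimately have "rank_of (dual N) A \<in> card ` {I \<in> indeps (dual N). I \<subseteq> A}"
    unfolding rank_of_def by (rule Max_in)
  then obtain I where I: "I \<in> indeps (dual N)" "I \<subseteq> A" "card I = rank_of (dual N) A"
    by auto
  obtain B where B: "B \<in> indeps N" "card B = rank N" "I \<subseteq> ground N - B"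
    using I by (auto simp: dual_def basis_iff_card)
  have "card (B - A) \<le> rank_of N (ground N - A)"
    using B(1) indep_mono indep_subset_ground[OF B(1)] by (intro card_le_rank_of) auto
  moreover have "card I + card (B \<inter> A) = card (I \<union> (B \<inter> A))"
    using I B finA finite_subset by (intro card_Un_disjoint[symmetric]) auto
  moreover have "\<dots> \<le> card A"
    using I finA by (intro card_mono) auto
  moreover have "card B = card (B \<inter> A) + card (B - A)"
    using finite_indep[OF B(1)] by (metis card_Int_Diff)
  ultimately show "rank_of (dual N) A + rank N \<le> card A + rank_of N (ground N - A)"
    using I B by simp
qed

text \<open>The dual rank formula at \<open>A\<close> and at \<open>insert e A\<close> shows that
  \<open>e\<close> raises exactly one of two ranks: the dual rank of \<open>A\<close> or the rank of
  \<open>ground N - insert e A\<close>.\<close>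

lemma cl_dual:
  assumes "A \<subseteq> ground N" "e \<in> ground N - A"
  shows "e \<in> cl (dual N) A \<longleftrightarrow> e \<notin> cl N (ground N - insert e A)"
proof -
  have ins: "ground N - A = insert e (ground N - insert e A)" using assms by auto
  have "finite A" using assms finite_ground finite_subset by blast
  then have "card (insert e A) = Suc (card A)" using assms by simp
  moreover have "rank_of (dual N) (insert e A) + rank N = card (insert e A) + rank_of N (ground N - insert e A)"
    using assms by (intro rank_of_dual) auto
  moreover have "rank_of (dual N) A + rank N = card A + rank_of N (ground N - A)"
    using assms by (intro rank_of_dual) auto
  moreover have "rank_of N (ground N - A) = (if e \<in> cl N (ground N - insert e A)
      then rank_of N (ground N - insert e A) else Suc (rank_of N (ground N - insert e A)))"
    unfolding ins using assms by (intro rank_of_insert) auto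
  ultimately show ?thesis
    using assms by (auto simp: cl_def split: if_splits)
qed

lemma spanning_iff_indep_dual:
  "B \<subseteq> ground N \<Longrightarrow> spanning N B \<longleftrightarrow> ground N - B \<in> indeps (dual N)"
  by (auto simp: spanning_def indep_dual_iff double_diff)

section \<open>Ranks of restrictions and contractions\<close>

lemma rank_of_restriction: "A \<subseteq> X \<Longrightarrow> rank_of (restriction N X) A = rank_of N A"
  unfolding rank_of_def restriction_def by (rule arg_cong[where f = "\<lambda>S. Max (card ` S)"]) auto

lemma rank_restriction: "rank (restriction N X) = rank_of N X"
  unfolding rank_def by (subst rank_of_restriction) (auto simp: restriction_def)

lemma matroid_restriction:
  assumes "X \<subseteq> ground N" shows "matroid (restriction N X)"
  unfolding matroid_def
proof (intro conjI allI impI)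
  show "finite (ground (restriction N X))"
    using assms finite_ground finite_subset by (auto simp: restriction_def)
  fix I J assume "I \<in> indeps (restriction N X)" "J \<in> indeps (restriction N X)" "card I < card J"
  then show "\<exists>e \<in> J - I. insert e I \<in> indeps (restriction N X)"
    using indep_augment[of I J] by (auto simp: restriction_def)
qed (use indep_empty indep_mono in \<open>auto simp: restriction_def\<close>)

end

text \<open>The exponent of \<open>y\<close> is the nullity of \<open>X\<close>: in the dual rank
  formula for the restriction with \<open>A = X\<close> the complement is empty.\<close>

lemma rank_dual_restriction:
  assumes N: "matroid N" and X: "X \<subseteq> ground N"
  shows "rank (dual (restriction N X)) + rank_of N X = card X"
proof -
  have "rank_of (dual (restriction N X)) X + rank (restriction N X)
      = card X + rank_of (restriction N X) (X - X)"
    using rank_of_dual[OF matroid_restriction[OF N X], of X] by (simp add: restriction_def)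
  moreover have "rank_of (restriction N X) {} = 0"
    using rank_of_indep[OF matroid_restriction[OF N X] indep_empty[OF matroid_restriction[OF N X]]]
    by simp
  moreover have "rank (dual (restriction N X)) = rank_of (dual (restriction N X)) X"
    by (simp add: rank_def dual_def restriction_def)
  ultimately show ?thesis by (simp add: rank_restriction[OF N])
qed

text \<open>An independent set of the contraction joined with a maximum independent subset of
  \<open>X\<close> has at most \<open>rank N\<close> elements, and a basis of \<open>N\<close>
  extending such a subset attains the bound.\<close>

lemma rank_contraction:
  assumes N: "matroid N" and X: "X \<subseteq> ground N"
  shows "rank (contraction N X) + rank_of N X = rank N"
proof -
  have bas: "basis (restriction N X) J \<longleftrightarrow> J \<in> indeps N \<and> J \<subseteq> X \<and> card J = rank_of N X" for J
    using basis_iff_card[OF matroid_restriction[OF N X]] rank_restriction[OF N]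
    by (auto simp: restriction_def)
  have "rank (contraction N X) = rank N - rank_of N X"
    unfolding rank_def[of "contraction N X"] rank_of_def[of "contraction N X"]
  proof (rule Max_eqI)
    let ?S = "{I \<in> indeps (contraction N X). I \<subseteq> ground (contraction N X)}"
    show "finite (card ` ?S)"
      by (rule finite_imageI, rule finite_subset[of _ "Pow (ground N)"])
        (auto simp: contraction_def finite_ground[OF N])
    show "k \<le> rank N - rank_of N X" if k: "k \<in> card ` ?S" for k
    proof -
      obtain I J where IJ: "k = card I" "I \<subseteq> ground N - X" "J \<in> indeps N" "J \<subseteq> X"
          "card J = rank_of N X" "I \<union> J \<in> indeps N"
        using k by (auto simp: contraction_def bas)
      have "card (I \<union> J) = card I + card J"
        using IJ finite_indep[OF N IJ(6)] by (intro card_Un_disjoint) auto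
      moreover have "card (I \<union> J) \<le> rank N"
        unfolding rank_def using card_le_rank_of[OF N IJ(6)] indep_subset_ground[OF N IJ(6)] by blast
      ultimately show ?thesis using IJ by simp
    qed
    obtain J where J: "J \<in> indeps N" "J \<subseteq> X" "card J = rank_of N X"
      by (rule rank_of_attained[OF N])
    obtain B where B: "B \<in> indeps N" "J \<subseteq> B" "B \<subseteq> ground N" "card B = rank N"
      using indep_extend[OF N J(1), of "ground N"] J X unfolding rank_def by blast
    \<comment> \<open>\<open>B \<inter> X\<close> is independent inside \<open>X\<close>, so it
      cannot outgrow \<open>J\<close>; hence \<open>B\<close> meets \<open>X\<close> exactly in
      \<open>J\<close>.\<close>
    have "card (B \<inter> X) \<le> card J"
      using card_le_rank_of[OF N indep_mono[OF N B(1)], of "B \<inter> X" X] J by simp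
    moreover have "J \<subseteq> B \<inter> X" using J B by blast
    ultimately have BX: "B \<inter> X = J"
      using card_seteq[of "B \<inter> X" J] finite_indep[OF N B(1)] by auto
    have mem: "B - X \<in> ?S"
      using B J BX indep_mono[OF N B(1), of "B - X \<union> J"] by (auto simp: contraction_def bas)
    have card: "card (B - X) = rank N - rank_of N X"
      using card_Int_Diff[OF finite_indep[OF N B(1)], of X] B J BX by simp
    show "rank N - rank_of N X \<in> card ` ?S"
      unfolding card[symmetric] using mem by (rule imageI)
  qed
  then show ?thesis
    using rank_of_mono[OF N X] by (simp add: rank_def)
qed

section \<open>Activities of arbitrary subsets\<close>

definition above :: "'a rel \<Rightarrow> 'a set \<Rightarrow> 'a \<Rightarrow> 'a set" where
  "above lt X e = {f \<in> X. (e, f) \<in> lt}"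

definition below :: "'a rel \<Rightarrow> 'a set \<Rightarrow> 'a \<Rightarrow> 'a set" where
  "below lt X e = {f \<in> X. (f, e) \<in> lt}"

text \<open>Unlike \<open>int_active\<close> and \<open>ext_active\<close>, activity here does not depend on
  whether the element belongs to \<open>X\<close>.\<close>
definition active :: "'a pre_matroid \<Rightarrow> 'a rel \<Rightarrow> 'a set \<Rightarrow> 'a set" where
  "active N lt X = {e \<in> ground N. e \<in> cl N (above lt X e)}"

locale ordered_matroid =
  fixes N :: "'a pre_matroid" and lt :: "'a rel"
  assumes N: "matroid N" and lt: "strict_linear_order_on (ground N) lt"
begin

lemma not_less_self: "(e, e) \<notin> lt"
  using lt by (auto simp: strict_linear_order_on_def irrefl_def)

lemma less_trans: "(e, f) \<in> lt \<Longrightarrow> (f, g) \<in> lt \<Longrightarrow> (e, g) \<in> lt"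
  using lt by (auto simp: strict_linear_order_on_def dest: transD)

lemma less_total: "e \<in> ground N \<Longrightarrow> f \<in> ground N \<Longrightarrow> e \<noteq> f \<Longrightarrow> (e, f) \<in> lt \<or> (f, e) \<in> lt"
  using lt by (auto simp: strict_linear_order_on_def total_on_def)

text \<open>The elements of a circuit other than its minimum \<open>e\<close> lie above
  \<open>e\<close>, so the circuits in question are those through \<open>e\<close> inside
  \<open>insert e (above lt X e)\<close>. As \<open>e\<close> is not above itself,
  \<open>e \<in> X\<close> and \<open>e \<notin> X\<close> are treated alike.\<close>

lemma mem_active_iff_circuit:
  assumes "e \<in> ground N" "X \<subseteq> ground N"
  shows "e \<in> active N lt X \<longleftrightarrow> (\<exists>C. circuit N C \<and> C \<subseteq> insert e X \<and> is_minimum lt C e)"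
proof -
  have "above lt X e \<subseteq> ground N" "e \<notin> above lt X e"
    using assms not_less_self by (auto simp: above_def)
  then have "e \<in> active N lt X \<longleftrightarrow> (\<exists>C. circuit N C \<and> e \<in> C \<and> C \<subseteq> insert e (above lt X e))"
    using mem_cl_iff_circuit[OF N assms(1)] assms by (simp add: active_def)
  moreover have "e \<in> C \<and> C \<subseteq> insert e (above lt X e) \<longleftrightarrow> C \<subseteq> insert e X \<and> is_minimum lt C e" for C
    unfolding above_def is_minimum_def by blast
  ultimately show ?thesis by simp
qed

lemma ex_minimum:
  assumes "finite C" "C \<noteq> {}" "C \<subseteq> ground N"
  shows "\<exists>e. is_minimum lt C e"
  using assms
proof (induction rule: finite_ne_induct)
  case (singleton x)
  then show ?case by (auto simp: is_minimum_def)
next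
  case (insert x F)
  then obtain m where m: "is_minimum lt F m" by auto
  then have "x \<noteq> m" "m \<in> ground N" using insert by (auto simp: is_minimum_def)
  then consider "(x, m) \<in> lt" | "(m, x) \<in> lt" using less_total insert by blast
  then show ?case
  proof cases
    case 1
    then have "is_minimum lt (insert x F) x"
      using m less_trans by (auto simp: is_minimum_def)
    then show ?thesis by blast
  next
    case 2
    then have "is_minimum lt (insert x F) m"
      using m by (auto simp: is_minimum_def)
    then show ?thesis by blast
  qed
qed

text \<open>The active elements lying in \<open>X\<close> are the minima of the circuits inside
  \<open>X\<close>.\<close>

lemma indep_iff_no_active:
  assumes X: "X \<subseteq> ground N"
  shows "X \<in> indeps N \<longleftrightarrow> X \<inter> active N lt X = {}"
proof
  assume "X \<in> indeps N"
  then have "\<not> (\<exists>C. circuit N C \<and> C \<subseteq> X)"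
    using circuit_subset_dependent[OF N] by metis
  moreover have "\<exists>C. circuit N C \<and> C \<subseteq> X" if e: "e \<in> X" "e \<in> active N lt X" for e
    using mem_active_iff_circuit[of e X] e X by (auto simp: insert_absorb)
  ultimately show "X \<inter> active N lt X = {}"
    by blast
next
  assume none: "X \<inter> active N lt X = {}"
  show "X \<in> indeps N"
  proof (rule ccontr)
    assume "X \<notin> indeps N"
    then obtain C where C: "circuit N C" "C \<subseteq> X"
      using dependent_contains_circuit[OF N X] by blast
    then have "finite C" "C \<noteq> {}" "C \<subseteq> ground N"
      using X finite_ground[OF N] indep_empty[OF N] finite_subset by (auto simp: circuit_def)
    then obtain e where e: "is_minimum lt C e" using ex_minimum by blast
    then have "e \<in> X" using C by (auto simp: is_minimum_def)
    then have "e \<in> active N lt X"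
      using mem_active_iff_circuit[of e X] X C e by blast
    then show False using none \<open>e \<in> X\<close> by blast
  qed
qed

lemma ext_active_eq: "X \<subseteq> ground N \<Longrightarrow> ext_active N lt X = active N lt X - X"
  using mem_active_iff_circuit[of _ X] by (auto simp: ext_active_def active_def)

text \<open>A circuit with minimum \<open>e\<close> meets \<open>X\<close> only in \<open>e\<close>
  when its remaining elements lie in the complement, so the activities that matter are those of
  \<open>ground N - X\<close>.\<close>

lemma compatible_iff:
  assumes X: "X \<subseteq> ground N"
  shows "compatible N lt X \<longleftrightarrow> active N lt (ground N - X) \<inter> X = {}"
proof -
  have "X \<inter> C = {e} \<longleftrightarrow> e \<in> X \<and> C \<subseteq> insert e (ground N - X)"
    if "circuit N C" "is_minimum lt C e" for C e
    using that X by (auto simp: circuit_def is_minimum_def)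
  then have "compatible N lt X \<longleftrightarrow>
      \<not> (\<exists>e \<in> X. \<exists>C. circuit N C \<and> C \<subseteq> insert e (ground N - X) \<and> is_minimum lt C e)"
    unfolding compatible_def by blast
  also have "\<dots> \<longleftrightarrow> active N lt (ground N - X) \<inter> X = {}"
    using mem_active_iff_circuit[of _ "ground N - X"] X by (meson Diff_subset disjoint_iff subsetD)
  finally show ?thesis .
qed

lemma ordered_matroid_dual: "ordered_matroid (dual N) lt"
  using matroid_dual[OF N] lt by unfold_locales (simp_all add: ground_dual[OF N])

lemma int_active_eq: "X \<subseteq> ground N \<Longrightarrow> int_active N lt X = active (dual N) lt (ground N - X) \<inter> X"
  using ordered_matroid.mem_active_iff_circuit[OF ordered_matroid_dual, of _ "ground N - X"]
  by (auto simp: int_active_def active_def ground_dual[OF N])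

lemma spanning_iff_no_active:
  "X \<subseteq> ground N \<Longrightarrow> spanning N X \<longleftrightarrow> active (dual N) lt (ground N - X) \<subseteq> X"
  using ordered_matroid.indep_iff_no_active[OF ordered_matroid_dual, of "ground N - X"]
  by (auto simp: spanning_iff_indep_dual[OF N] ground_dual[OF N] active_def)

text \<open>\<open>cl_dual\<close> turns closure in the dual into non-closure in \<open>N\<close> of
  the complementary set. Totality of the order identifies that set: everything below
  \<open>e\<close>, and above \<open>e\<close> only elements of \<open>X\<close>.\<close>

lemma active_dual_eq:
  assumes X: "X \<subseteq> ground N"
  shows "active (dual N) lt (ground N - X) =
    {e \<in> ground N. e \<notin> cl N (above lt X e \<union> below lt (ground N) e)}"
proof -
  have "ground N - insert e (above lt (ground N - X) e) = above lt X e \<union> below lt (ground N) e"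
    if "e \<in> ground N" for e
  proof (intro equalityI subsetI)
    fix f assume "f \<in> ground N - insert e (above lt (ground N - X) e)"
    then show "f \<in> above lt X e \<union> below lt (ground N) e"
      using less_total[OF that, of f] by (auto simp: above_def below_def)
  next
    fix f assume f: "f \<in> above lt X e \<union> below lt (ground N) e"
    have "f \<noteq> e" "\<not> ((e, f) \<in> lt \<and> (f, e) \<in> lt)"
      using f not_less_self less_trans[of e f e] by (auto simp: above_def below_def)
    then show "f \<in> ground N - insert e (above lt (ground N - X) e)"
      using f X by (auto simp: above_def below_def)
  qed
  moreover have "above lt (ground N - X) e \<subseteq> ground N" "e \<notin> above lt (ground N - X) e" for e
    using not_less_self by (auto simp: above_def)
  ultimately show ?thesis
    using cl_dual[OF N] by (auto simp: active_def ground_dual[OF N])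
qed

end

section \<open>Toggling active elements\<close>

locale ordered_perspective =
  fixes M M' :: "'a pre_matroid" and lt :: "'a rel"
  assumes perspective: "matroid_perspective M M'"
    and lt: "strict_linear_order_on (ground M) lt"
begin

lemma M: "matroid M" and M': "matroid M'" and ground_eq: "ground M' = ground M"
  using perspective by (auto simp: matroid_perspective_def)

sublocale M: ordered_matroid M lt
  by unfold_locales (fact M lt)+

sublocale M': ordered_matroid M' lt
  by unfold_locales (simp_all add: M' lt ground_eq)

text \<open>A circuit of \<open>M\<close> through \<open>e\<close> is a union of circuits of
  \<open>M'\<close>, one of which passes through \<open>e\<close>. The circuit condition of a
  perspective enters the argument only here.\<close>

lemma cl_subset_cl:
  assumes A: "A \<subseteq> ground M" shows "cl M A \<subseteq> cl M' A"
proof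
  fix e assume e: "e \<in> cl M A"
  then have eg: "e \<in> ground M" using cl_subset_ground[OF M] by blast
  show "e \<in> cl M' A"
  proof (cases "e \<in> A")
    case True
    then show ?thesis using subset_cl[OF M'] A ground_eq by auto
  next
    case False
    obtain C where C: "circuit M C" "e \<in> C" "C \<subseteq> insert e A"
      using mem_cl_iff_circuit[OF M eg A False] e by blast
    then obtain \<D> where "\<forall>D \<in> \<D>. circuit M' D" "C = \<Union>\<D>"
      using perspective unfolding matroid_perspective_def by metis
    then obtain D where "circuit M' D" "e \<in> D" "D \<subseteq> insert e A"
      using C by blast
    then show ?thesis
      using mem_cl_iff_circuit[OF M', of e A] eg A False ground_eq by auto
  qed
qed

definition ext_act :: "'a set \<Rightarrow> 'a set" where
  "ext_act X = active M lt X"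

definition int_act :: "'a set \<Rightarrow> 'a set" where
  "int_act X = active (dual M') lt (ground M - X)"

abbreviation outer :: "'a set \<Rightarrow> 'a \<Rightarrow> 'a set" where
  "outer X e \<equiv> above lt X e \<union> below lt (ground M) e"

lemma mem_ext_act_iff: "e \<in> ext_act X \<longleftrightarrow> e \<in> ground M \<and> e \<in> cl M (above lt X e)"
  by (simp add: ext_act_def active_def)

lemma mem_int_act_iff: "X \<subseteq> ground M \<Longrightarrow> e \<in> int_act X \<longleftrightarrow> e \<in> ground M \<and> e \<notin> cl M' (outer X e)"
  using M'.active_dual_eq[of X] by (simp add: int_act_def ground_eq)

lemma outer_subset: "X \<subseteq> ground M \<Longrightarrow> outer X e \<subseteq> ground M"
  by (auto simp: above_def below_def)

text \<open>An externally active \<open>e\<close> lies in the closure of \<open>above lt X e\<close>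
  in \<open>M\<close>, hence in \<open>M'\<close>, hence in the closure of the larger set
  \<open>outer X e\<close>.\<close>

lemma ext_int_act_disjoint:
  assumes "X \<subseteq> ground M" shows "ext_act X \<inter> int_act X = {}"
proof -
  have "cl M (above lt X e) \<subseteq> cl M' (outer X e)" for e
    using cl_subset_cl[of "above lt X e"] cl_mono[OF M', of "above lt X e" "outer X e"]
      outer_subset[OF assms, of e] ground_eq by auto
  then show ?thesis
    using mem_int_act_iff[OF assms] by (simp add: disjoint_iff mem_ext_act_iff) (meson subsetD)
qed

text \<open>Only elements \<open>e\<close> below \<open>f\<close> see the insertion. An externally
  active \<open>f\<close> already lies in the closures involved and is absorbed. An internally
  active \<open>f\<close> lies outside them even with \<open>e\<close> added, so by exchange it
  cannot bring \<open>e\<close> in.\<close>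

lemma ext_int_act_insert:
  assumes X: "X \<subseteq> ground M" and f: "f \<in> ext_act X \<union> int_act X" "f \<notin> X"
  shows "ext_act (insert f X) = ext_act X" "int_act (insert f X) = int_act X"
proof -
  have fg: "f \<in> ground M" using f X by (auto simp: mem_ext_act_iff mem_int_act_iff)
  have key: "(e \<in> cl M (above lt (insert f X) e) \<longleftrightarrow> e \<in> cl M (above lt X e)) \<and>
      (e \<in> cl M' (outer (insert f X) e) \<longleftrightarrow> e \<in> cl M' (outer X e))" if e: "e \<in> ground M" for e
  proof (cases "(e, f) \<in> lt")
    case False
    then have "above lt (insert f X) e = above lt X e" by (auto simp: above_def)
    then show ?thesis by simp
  next
    case True
    have ins: "above lt (insert f X) e = insert f (above lt X e)"
      using True by (auto simp: above_def)
    have sub1: "above lt X f \<subseteq> above lt X e"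
      using True M.less_trans by (auto simp: above_def)
    \<comment> \<open>Moving up from \<open>e\<close> to \<open>f\<close> enlarges the outer set: an
      element of \<open>X\<close> above \<open>e\<close> is above or below \<open>f\<close>, because
      \<open>f \<notin> X\<close>.\<close>
    have sub2: "insert e (outer X e) \<subseteq> outer X f"
    proof
      fix g assume g: "g \<in> insert e (outer X e)"
      then have "g \<in> ground M" using e X by (auto simp: above_def below_def)
      moreover have "g \<in> X \<or> (g, f) \<in> lt"
        using g True M.less_trans[of g e f] by (auto simp: above_def below_def)
      ultimately show "g \<in> outer X f"
        using M.less_total[OF fg, of g] f(2) by (auto simp: above_def below_def)
    qed
    have gr: "above lt X e \<subseteq> ground M" "outer X e \<subseteq> ground M" "outer X f \<subseteq> ground M"
      using outer_subset[OF X] by auto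
    show ?thesis
    proof (cases "f \<in> ext_act X")
      case True
      then have "f \<in> cl M (above lt X f)" by (simp add: mem_ext_act_iff)
      then have fM: "f \<in> cl M (above lt X e)"
        using cl_mono[OF M sub1 gr(1)] by blast
      then have "f \<in> cl M' (above lt X e)"
        using cl_subset_cl[OF gr(1)] by blast
      then have "f \<in> cl M' (outer X e)"
        using cl_mono[OF M', of "above lt X e" "outer X e"] gr ground_eq by auto
      then show ?thesis
        using cl_insert_absorb[OF M fM gr(1)] cl_insert_absorb[OF M', of f "outer X e"]
          gr(2) ground_eq ins by simp
    next
      case False
      then have notin: "f \<notin> cl M' (outer X f)" using f X by (simp add: mem_int_act_iff)
      then have nM': "f \<notin> cl M' (insert e (outer X e))"
        using cl_mono[OF M' sub2] gr(3) ground_eq by auto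
      have "f \<notin> cl M (outer X f)"
        using notin cl_subset_cl[OF gr(3)] by blast
      then have nM: "f \<notin> cl M (insert e (above lt X e))"
        using cl_mono[OF M, of "insert e (above lt X e)" "outer X f"] sub2 gr(3) by auto
      have "cl M (above lt X e) \<subseteq> cl M (insert f (above lt X e))"
        using gr fg by (intro cl_mono[OF M]) auto
      moreover have "cl M' (outer X e) \<subseteq> cl M' (insert f (outer X e))"
        using gr fg ground_eq by (intro cl_mono[OF M']) auto
      \<comment> \<open>If \<open>e\<close> entered a closure through \<open>f\<close>, exchange
        would put \<open>f\<close> into the closure of the same set with \<open>e\<close>, against
        \<open>nM\<close> or \<open>nM'\<close>.\<close>
      ultimately show ?thesis
        using cl_exchange[OF M _ _ fg, of e "above lt X e"]
          cl_exchange[OF M', of e f "outer X e"] nM nM' fg ground_eq ins by auto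
    qed
  qed
  show "ext_act (insert f X) = ext_act X"
    using key by (auto simp: mem_ext_act_iff)
  show "int_act (insert f X) = int_act X"
    using key X fg by (auto simp: mem_int_act_iff)
qed

text \<open>Since \<open>X \<subseteq> outer X f\<close>, an internally active \<open>f\<close> lies
  outside the closure of \<open>X\<close> in \<open>M'\<close> and so in \<open>M\<close>; an
  externally active one lies in both closures. The two ranks rise together or not at all.\<close>

lemma rank_of_insert_active:
  assumes X: "X \<subseteq> ground M" and f: "f \<in> ext_act X \<union> int_act X" "f \<notin> X"
  shows "rank_of M (insert f X) = rank_of M X + (if f \<in> int_act X then 1 else 0)"
    "rank_of M' (insert f X) = rank_of M' X + (if f \<in> int_act X then 1 else 0)"
proof -
  have fg: "f \<in> ground M" using f X by (auto simp: mem_ext_act_iff mem_int_act_iff)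
  have "X \<subseteq> outer X f"
  proof
    fix g assume "g \<in> X"
    then show "g \<in> outer X f"
      using M.less_total[OF fg, of g] f(2) X by (auto simp: above_def below_def)
  qed
  then have "cl M' X \<subseteq> cl M' (outer X f)"
    using cl_mono[OF M'] outer_subset[OF X] ground_eq by metis
  then have "f \<in> int_act X \<Longrightarrow> f \<notin> cl M' X"
    using X by (auto simp: mem_int_act_iff)
  moreover have "f \<in> cl M X" if "f \<notin> int_act X"
  proof -
    have "f \<in> cl M (above lt X f)" using that f by (simp add: mem_ext_act_iff)
    then show ?thesis
      using cl_mono[OF M _ X, of "above lt X f"] by (auto simp: above_def)
  qed
  ultimately show "rank_of M (insert f X) = rank_of M X + (if f \<in> int_act X then 1 else 0)"
    "rank_of M' (insert f X) = rank_of M' X + (if f \<in> int_act X then 1 else 0)"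
    using rank_of_insert[OF M fg, of X] rank_of_insert[OF M', of f X] fg ground_eq
      cl_subset_cl[OF X] by auto
qed

text \<open>The invariants behind the exponents: on an index set of the Tutte sum the third
  component is \<open>rank M'\<close> and the fourth is zero. The activity sets are included so that
  elements stay active while others are toggled.\<close>

definition profile :: "'a set \<Rightarrow> 'a set \<times> 'a set \<times> nat \<times> int \<times> int" where
  "profile X = (ext_act X, int_act X, rank_of M' X + card (int_act X - X),
     of_nat (card X) - of_nat (rank_of M X) - of_nat (card (ext_act X \<inter> X)),
     of_nat (rank_of M X) - of_nat (rank_of M' X))"

text \<open>An internally active \<open>f\<close> raises \<open>card X\<close> and both ranks while
  \<open>int_act X - X\<close> loses \<open>f\<close>; an externally active one raises only
  \<open>card X\<close> and \<open>card (ext_act X \<inter> X)\<close>. The changes cancel in every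
  component.\<close>

lemma profile_insert:
  assumes X: "X \<subseteq> ground M" and f: "f \<in> ext_act X \<union> int_act X" "f \<notin> X"
  shows "profile (insert f X) = profile X"
proof -
  have fin: "finite (ground M)" by (rule finite_ground[OF M])
  have finX: "finite X" "finite (int_act X)" "finite (ext_act X)"
    using X fin by (auto simp: mem_ext_act_iff mem_int_act_iff intro: finite_subset[OF _ fin])
  have disj: "f \<in> ext_act X \<longleftrightarrow> f \<notin> int_act X" using ext_int_act_disjoint[OF X] f by blast
  have "card (int_act X - X) = card (int_act X - insert f X) + (if f \<in> int_act X then 1 else 0)"
  proof (cases "f \<in> int_act X")
    case True
    then have eq: "int_act X - X = insert f (int_act X - insert f X)" using f by blast
    have "card (insert f (int_act X - insert f X)) = Suc (card (int_act X - insert f X))"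
      using finX by (intro card_insert_disjoint) auto
    then show ?thesis using True eq by presburger
  next
    case False
    then have "int_act X - X = int_act X - insert f X" by blast
    then show ?thesis using False by simp
  qed
  moreover have "card (ext_act X \<inter> insert f X) = card (ext_act X \<inter> X) + (if f \<in> ext_act X then 1 else 0)"
    using finX f by auto
  moreover have "card (insert f X) = card X + 1"
    using finX f by simp
  ultimately show ?thesis
    using disj by (auto simp: profile_def ext_int_act_insert[OF X f] rank_of_insert_active[OF X f])
qed

text \<open>Elements are toggled one at a time; each is still active when its turn comes, and a
  removal is an insertion read backwards.\<close>

lemma profile_sym_diff:
  assumes "X \<subseteq> ground M" "finite S" "S \<subseteq> ext_act X \<union> int_act X"
  shows "profile (sym_diff X S) = profile X"
  using assms(2,3)
proof (induction S rule: finite_induct)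
  case (insert f S)
  define Y where "Y = sym_diff X S"
  have eq: "profile Y = profile X" using insert by (simp add: Y_def)
  then have f: "f \<in> ext_act Y \<union> int_act Y" using insert by (simp add: profile_def)
  have Y: "Y \<subseteq> ground M"
    using insert.prems assms(1) by (auto simp: Y_def mem_ext_act_iff mem_int_act_iff)
  show ?case
  proof (cases "f \<in> Y")
    case False
    then have "sym_diff X (insert f S) = insert f Y" using insert.hyps by (auto simp: Y_def)
    then show ?thesis using profile_insert[OF Y f False] eq by simp
  next
    case True
    then have diff: "sym_diff X (insert f S) = Y - {f}" using insert.hyps by (auto simp: Y_def)
    \<comment> \<open>Activity of \<open>f\<close> looks only at elements other than
      \<open>f\<close>, so \<open>f\<close> is active for \<open>Y - {f}\<close> too.\<close>
    have "above lt (Y - {f}) f = above lt Y f"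
      using M.not_less_self by (auto simp: above_def)
    moreover have "Y - {f} \<subseteq> ground M" using Y by blast
    ultimately have "f \<in> ext_act (Y - {f}) \<union> int_act (Y - {f})"
      using f by (simp add: mem_ext_act_iff mem_int_act_iff Y)
    then have "profile (insert f (Y - {f})) = profile (Y - {f})"
      using Y by (intro profile_insert) auto
    then show ?thesis using True diff eq by (simp add: insert_absorb)
  qed
qed simp

definition toggle :: "'a set \<Rightarrow> 'a set" where
  "toggle X = sym_diff X (ext_act X \<union> int_act X)"

lemma profile_toggle: "X \<subseteq> ground M \<Longrightarrow> profile (toggle X) = profile X"
  unfolding toggle_def
  by (rule profile_sym_diff) (auto simp: mem_ext_act_iff mem_int_act_iff intro: finite_subset[OF _ finite_ground[OF M]])

lemma toggle_subset: "X \<subseteq> ground M \<Longrightarrow> toggle X \<subseteq> ground M"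
  by (auto simp: toggle_def mem_ext_act_iff mem_int_act_iff)

lemma toggle_toggle:
  assumes "X \<subseteq> ground M" shows "toggle (toggle X) = X"
proof -
  have "ext_act (toggle X) = ext_act X" "int_act (toggle X) = int_act X"
    using profile_toggle[OF assms] by (auto simp: profile_def)
  then have "toggle (toggle X) = sym_diff (toggle X) (ext_act X \<union> int_act X)"
    by (simp add: toggle_def[of "toggle X"])
  then show ?thesis by (auto simp: toggle_def)
qed

section \<open>Matching index sets and exponents\<close>

lemma tutte_index_eq:
  "{B. B \<subseteq> ground M \<and> B \<in> indeps M \<and> spanning M' B} =
   {B. B \<subseteq> ground M \<and> B \<inter> ext_act B = {} \<and> int_act B \<subseteq> B}"
  using M.indep_iff_no_active M'.spanning_iff_no_active by (auto simp: ext_act_def int_act_def ground_eq)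

lemma compatible_sets_eq:
  "compatible_sets M M' lt = {X. X \<subseteq> ground M \<and> int_act X \<inter> X = {} \<and> ext_act X \<subseteq> X}"
proof -
  have "compatible (dual M') lt X \<longleftrightarrow> int_act X \<inter> X = {}" if "X \<subseteq> ground M" for X
    using ordered_matroid.compatible_iff[OF M'.ordered_matroid_dual, of X] that
    by (simp add: int_act_def ground_eq ground_dual[OF M'])
  moreover have "compatible M lt (ground M - X) \<longleftrightarrow> ext_act X \<subseteq> X" if "X \<subseteq> ground M" for X
    using M.compatible_iff[of "ground M - X"] that
    by (auto simp: ext_act_def double_diff active_def)
  ultimately show ?thesis by (auto simp: compatible_sets_def)
qed

text \<open>The profile is read at both ends. In \<open>toggle B\<close> all internally active
  elements are missing and all externally active ones present, so the third component equates their
  number with the corank of \<open>toggle B\<close> in \<open>M'\<close>, and the fourth with its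
  nullity in \<open>M\<close>.\<close>

lemma exponents_toggle:
  assumes B: "B \<subseteq> ground M" "B \<in> indeps M" "spanning M' B"
  shows "card (int_active M' lt B) = rank (contraction M' (toggle B))"
    "card (ext_active M lt B) = rank (dual (restriction M (toggle B)))"
    "z_exponent M M' B = z_exponent M M' (toggle B)"
proof -
  define X where "X = toggle B"
  have X: "X \<subseteq> ground M" using toggle_subset B by (simp add: X_def)
  have indep: "B \<inter> ext_act B = {}" and span: "int_act B \<subseteq> B"
    using B tutte_index_eq by blast+
  have "profile X = profile B" using profile_toggle B by (simp add: X_def)
  then have eq: "ext_act X = ext_act B" "int_act X = int_act B"
    "rank_of M' X + card (int_act X - X) = rank_of M' B + card (int_act B - B)"
    "int (card X) - int (rank_of M X) - int (card (ext_act X \<inter> X))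
      = int (card B) - int (rank_of M B) - int (card (ext_act B \<inter> B))"
    "int (rank_of M X) - int (rank_of M' X) = int (rank_of M B) - int (rank_of M' B)"
    by (auto simp: profile_def)
  have "int_act B - X = int_act B" "ext_act B \<inter> X = ext_act B"
    using indep span by (auto simp: X_def toggle_def)
  moreover have "card (int_act B - B) = 0" "ext_act B \<inter> B = {}" using indep span by (auto simp: Diff_eq_empty_iff[THEN iffD2])
  moreover have "rank_of M' B = rank M'" using B by (simp add: spanning_def)
  moreover have "rank_of M B = card B" using rank_of_indep[OF M] B by simp
  moreover have "rank (contraction M' X) + rank_of M' X = rank M'"
    using rank_contraction[OF M'] X ground_eq by simp
  moreover have "rank (dual (restriction M X)) + rank_of M X = card X"
    by (rule rank_dual_restriction[OF M X])
  moreover have "int_active M' lt B = int_act B"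
    using M'.int_active_eq[of B] B span by (auto simp: int_act_def ground_eq)
  moreover have "ext_active M lt B = ext_act B"
    using M.ext_active_eq[of B] B indep by (auto simp: ext_act_def)
  ultimately show "card (int_active M' lt B) = rank (contraction M' (toggle B))"
    "card (ext_active M lt B) = rank (dual (restriction M (toggle B)))"
    "z_exponent M M' B = z_exponent M M' (toggle B)"
    using eq unfolding X_def[symmetric] z_exponent_def by simp_all
qed

text \<open>Toggling keeps both activity sets and reverses membership on them. The first two
  equivalences lead from compatible sets to index sets of the Tutte sum, the last two back.\<close>

lemma toggle_swaps:
  assumes "X \<subseteq> ground M"
  shows "toggle X \<inter> ext_act (toggle X) = {} \<longleftrightarrow> ext_act X \<subseteq> X"
    "int_act (toggle X) \<subseteq> toggle X \<longleftrightarrow> int_act X \<inter> X = {}"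
    "int_act (toggle X) \<inter> toggle X = {} \<longleftrightarrow> int_act X \<subseteq> X"
    "ext_act (toggle X) \<subseteq> toggle X \<longleftrightarrow> X \<inter> ext_act X = {}"
proof -
  have "ext_act (toggle X) = ext_act X" "int_act (toggle X) = int_act X"
    using profile_toggle[OF assms] by (auto simp: profile_def)
  then show "toggle X \<inter> ext_act (toggle X) = {} \<longleftrightarrow> ext_act X \<subseteq> X"
    "int_act (toggle X) \<subseteq> toggle X \<longleftrightarrow> int_act X \<inter> X = {}"
    "int_act (toggle X) \<inter> toggle X = {} \<longleftrightarrow> int_act X \<subseteq> X"
    "ext_act (toggle X) \<subseteq> toggle X \<longleftrightarrow> X \<inter> ext_act X = {}"
    unfolding toggle_def using ext_int_act_disjoint[OF assms] by blast+
qed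

end

theorem corollary10:
  fixes M M' :: "'a pre_matroid"
    and E :: "'a set"
    and lt :: "'a rel"
    and x y z :: "'b::comm_ring_1"
  assumes "matroid_perspective M M'"
    and "ground M = E"
    and "strict_linear_order_on E lt"
  shows "trivariate_tutte M M' lt x y z =
    (\<Sum>X \<in> compatible_sets M M' lt.
       x ^ rank (contraction M' X) * y ^ rank (dual (restriction M X)) * z ^ z_exponent M M' X)"
proof -
  interpret ordered_perspective M M' lt
    using assms by unfold_locales auto
  show ?thesis
    unfolding trivariate_tutte_def
  proof (rule sum.reindex_bij_witness[where i = toggle and j = toggle])
    fix B assume B: "B \<in> {B. B \<subseteq> ground M \<and> B \<in> indeps M \<and> spanning M' B}"
    then show "toggle (toggle B) = B" using toggle_toggle by simp
    show "toggle B \<in> compatible_sets M M' lt"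
      using B toggle_subset toggle_swaps unfolding tutte_index_eq compatible_sets_eq by simp
    show "x ^ rank (contraction M' (toggle B)) * y ^ rank (dual (restriction M (toggle B))) *
        z ^ z_exponent M M' (toggle B) =
      x ^ card (int_active M' lt B) * y ^ card (ext_active M lt B) * z ^ z_exponent M M' B"
      using B exponents_toggle[of B] by simp
  next
    fix X assume X: "X \<in> compatible_sets M M' lt"
    then show "toggle (toggle X) = X" using toggle_toggle by (simp add: compatible_sets_eq)
    show "toggle X \<in> {B. B \<subseteq> ground M \<and> B \<in> indeps M \<and> spanning M' B}"
      using X toggle_subset toggle_swaps unfolding tutte_index_eq compatible_sets_eq by simp
  qed
qed

end
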